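(* Let $F:\Delta\to\mathbb R^n$ be smooth and let $\tilde\Gamma$ be a path on the fixed-point bundle $E$ of ${\rm VI}(F,\Delta)$ with finitely many segments, ending at $(\sigma^\star,\mathbf 0)$, such that $\tilde\Gamma\cap S\subseteq\{(\sigma^\star,\mathbf 0)\}$. Let $\zeta\neq0$ if $J(\sigma^\star)$ is singular. Then for any $\zeta\ge0$ (subject to this restriction), there exists $d>0$ such that $\mathcal N_{\tilde\Gamma}(\zeta)\cap S=\varnothing$.
   Context: Notation. $\Delta=\{\sigma\in\mathbb R^n:\sigma\ge0,\ \mathbf 1^\top\sigma=1\}$, $\mathbf 1$ the all-ones vector. Vector inequalities, $\circ$ and $\ln$ are componentwise; for a matrix $A$ and vector $b$, $A\circ b=A\,{\rm diag}(b)$ and $b\circ A={\rm diag}(b)A$. $\|\cdot\|$ is the Euclidean norm. ${\rm softmax}(\theta)=\exp(\theta)/(\mathbf 1^\top\exp(\theta))$. $F$ smooth on $\Delta$ means it extends smoothly to a neighborhood. Bundle. $G(\sigma,\mu)=(I-\sigma\mathbf 1^\top)(\sigma\circ F(\sigma)-\mu)$; $E=\{(\sigma,\mu)\in\Delta\times\mathbb R^n:G(\sigma,\mu)=0\}=\{(\sigma,\sigma\circ F(\sigma)+v\sigma):\sigma\in\Delta,\ v\in\mathbb R\}$; $\tilde\mu(\sigma)=(I-\sigma\mathbf 1^\top)(\sigma\circ F(\sigma))$. $$J(\sigma)=(I-\mathbf 1\sigma^\top)\left(\frac{\partial F(\sigma)}{\partial\sigma}\circ\sigma+\left((I-\mathbf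 1\sigma^\top)F(\sigma)\right)\circ I\right)(I-\mathbf 1\sigma^\top)+k\mathbf 1\sigma^\top$$ with $k\neq0$ a fixed real scalar. The subspace $\ker(\sigma^\top)$ is $J(\sigma)$-invariant; let $\lambda_j^\perp(J(\sigma))$ be the real eigenvalues of $J(\sigma)$ other than the eigenvalue $k$ belonging to the eigenvector $\mathbf 1$, i.e. the real eigenvalues of $J(\sigma)|_{\ker(\sigma^\top)}$. The singular manifold is $S=\{(\sigma,\tilde\mu(\sigma)-\lambda_j^\perp(J(\sigma))\sigma):\lambda_j^\perp(J(\sigma))\in\mathbb R,\ \sigma\in\Delta\}$. Path. Given $\sigma_{\rm init}\in\Delta$ with positive entries and sufficiently large $v_{\rm init}$, a path is a set $$\tilde\Gamma=\bigcup_{i=1}^q\{(\sigma,\gamma\mu_i)\in E:\ \mu_i=\gamma_{i-1}\mu_{i-1}+\beta_i\sigma_{i-1},\ \gamma\in[\gamma_i,1]\},$$ with $\gamma_0\mu_0=v_{\rm init}\sigma_{\rm init}$, $(\sigma_0,\gamma_0\mu_0)\in E$, $\beta_i\in\mathbb R$, $\mu_i>0$ and $\gamma_q\mathbf 1^\top\mu_q=0$. Here the $i$-th segment is a curve: $\sigma$ is a continuous function of $\gamma\in[\gamma_i,1]$ that equals $\sigma_{i-1}$ at $\gamma=1$ and $\sigma_i$ at $\gamma=\gamma_i$. The end point is $(\sigma^\star,\mathbf 0)$, where $\sigma^\star=\sigma_q$ is a solution of ${\rm VI}(F,\Delta)$ (i.e. $\langle F(\sigma^\star),\sigma'-\sigma^\star\rangle\ge0$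 for all $\sigma'\in\Delta$). Neighborhood. For $\zeta\ge0$ and radius $d>0$, $\mathcal N_{\tilde\Gamma}(\zeta)$ is the closure of $\{({\rm softmax}(\theta),\mu):\|\theta-\ln\sigma_\mu\|\le d,\ (\sigma_\mu,\mu)\in\tilde\Gamma,\ \mathbf 1^\top\mu>\zeta\}$. *)

theory Defs
  imports "HOL-Analysis.Analysis"
begin

text \<open>
  On \<^typ>\<open>real ^ 'n\<close> the library's \<open>*\<close> is the componentwise product and \<open>1\<close> is the
  all-ones vector. Matrix products are always written \<open>**\<close> and \<open>*v\<close>, and the identity
  matrix is \<open>mat 1\<close>.
\<close>

definition simplex_set :: "(real ^ 'n) set" where
  "simplex_set = {\<sigma>. (\<forall>i. 0 \<le> \<sigma> $ i) \<and> 1 \<bullet> \<sigma> = 1}"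

text \<open>Iterated differentiability: all iterated directional derivatives up to order \<open>k\<close> exist
  and are continuous. Meant for open \<open>U\<close>.\<close>

fun k_times_diff_on :: "nat \<Rightarrow> ('a::real_normed_vector \<Rightarrow> 'b::real_normed_vector) \<Rightarrow> 'a set \<Rightarrow> bool" where
  "k_times_diff_on 0 f U \<longleftrightarrow> continuous_on U f"
| "k_times_diff_on (Suc k) f U \<longleftrightarrow>
     (\<forall>x\<in>U. f differentiable (at x)) \<and>
     (\<forall>v. k_times_diff_on k (\<lambda>x. frechet_derivative f (at x) v) U)"

text \<open>A map on the simplex is represented by a map on the whole space, of which only the values
  on a neighbourhood of the simplex are used: \<open>F\<close> stands for a smooth extension.\<close>

definition smooth_on_simplex :: "(real ^ 'n \<Rightarrow> real ^ 'n) \<Rightarrow> bool" where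
  "smooth_on_simplex F \<longleftrightarrow>
     (\<exists>U. open U \<and> simplex_set \<subseteq> U \<and> (\<forall>k. k_times_diff_on k F U))"

definition VI_solution :: "(real ^ 'n \<Rightarrow> real ^ 'n) \<Rightarrow> real ^ 'n \<Rightarrow> bool" where
  "VI_solution F \<sigma> \<longleftrightarrow>
     \<sigma> \<in> simplex_set \<and> (\<forall>\<sigma>'\<in>simplex_set. 0 \<le> F \<sigma> \<bullet> (\<sigma>' - \<sigma>))"

definition outer_product :: "real ^ 'n \<Rightarrow> real ^ 'n \<Rightarrow> real ^ 'n ^ 'n" where
  "outer_product u v = (\<chi> i j. u $ i * v $ j)"

definition diag_matrix :: "real ^ 'n \<Rightarrow> real ^ 'n ^ 'n" where
  "diag_matrix b = (\<chi> i j. if i = j then b $ i else 0)"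

definition bundle_map :: "(real ^ 'n \<Rightarrow> real ^ 'n) \<Rightarrow> real ^ 'n \<Rightarrow> real ^ 'n \<Rightarrow> real ^ 'n" where
  "bundle_map F \<sigma> \<mu> = (mat 1 - outer_product \<sigma> 1) *v (\<sigma> * F \<sigma> - \<mu>)"

definition fp_bundle :: "(real ^ 'n \<Rightarrow> real ^ 'n) \<Rightarrow> ((real ^ 'n) \<times> (real ^ 'n)) set" where
  "fp_bundle F = {(\<sigma>, \<mu>). \<sigma> \<in> simplex_set \<and> bundle_map F \<sigma> \<mu> = 0}"

definition mu_tilde :: "(real ^ 'n \<Rightarrow> real ^ 'n) \<Rightarrow> real ^ 'n \<Rightarrow> real ^ 'n" where
  "mu_tilde F \<sigma> = (mat 1 - outer_product \<sigma> 1) *v (\<sigma> * F \<sigma>)"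

definition bundle_J :: "(real ^ 'n \<Rightarrow> real ^ 'n) \<Rightarrow> real \<Rightarrow> real ^ 'n \<Rightarrow> real ^ 'n ^ 'n" where
  "bundle_J F k \<sigma> =
     (mat 1 - outer_product 1 \<sigma>)
       ** (jacobian F (at \<sigma>) ** diag_matrix \<sigma> + diag_matrix ((mat 1 - outer_product 1 \<sigma>) *v F \<sigma>))
       ** (mat 1 - outer_product 1 \<sigma>)
     + k *\<^sub>R outer_product 1 \<sigma>"

text \<open>The real eigenvalues of \<open>J \<sigma>\<close> restricted to the invariant hyperplane of vectors
  orthogonal to \<open>\<sigma>\<close>.\<close>

definition perp_eigenvalues :: "(real ^ 'n \<Rightarrow> real ^ 'n) \<Rightarrow> real \<Rightarrow> real ^ 'n \<Rightarrow> real set" where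
  "perp_eigenvalues F k \<sigma> =
     {ev. \<exists>w. w \<noteq> 0 \<and> \<sigma> \<bullet> w = 0 \<and> bundle_J F k \<sigma> *v w = ev *\<^sub>R w}"

definition singular_manifold :: "(real ^ 'n \<Rightarrow> real ^ 'n) \<Rightarrow> real \<Rightarrow> ((real ^ 'n) \<times> (real ^ 'n)) set" where
  "singular_manifold F k =
     {(\<sigma>, mu_tilde F \<sigma> - ev *\<^sub>R \<sigma>) |\<sigma> ev. \<sigma> \<in> simplex_set \<and> ev \<in> perp_eigenvalues F k \<sigma>}"

text \<open>\<open>bundle_path F \<sigma>_init v_init \<Gamma> \<sigma>_star\<close>: the set \<open>\<Gamma>\<close> is a path with finitely many
  segments which starts from the data \<open>\<sigma>_init\<close>, \<open>v_init\<close> and ends at \<open>(\<sigma>_star, 0)\<close>.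
  The function \<open>s i\<close> parametrises the \<open>i\<close>-th segment by \<open>g \<in> {\<gamma> i..1}\<close>. A bundle fibre may
  contain several points, so a segment is the graph of this continuous branch.
  Taking \<open>v_init\<close> large serves only to make such paths exist; no lower bound on it is imposed.\<close>

definition bundle_path ::
  "(real ^ 'n \<Rightarrow> real ^ 'n) \<Rightarrow> real ^ 'n \<Rightarrow> real \<Rightarrow> ((real ^ 'n) \<times> (real ^ 'n)) set \<Rightarrow> real ^ 'n \<Rightarrow> bool" where
  "bundle_path F \<sigma>_init v_init \<Gamma> \<sigma>_star \<longleftrightarrow>
     \<sigma>_init \<in> simplex_set \<and> (\<forall>j. 0 < \<sigma>_init $ j) \<and>
     (\<exists>(q :: nat) (\<gamma> :: nat \<Rightarrow> real) (\<beta> :: nat \<Rightarrow> real) (\<mu> :: nat \<Rightarrow> real ^ 'n)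
        (\<sigma> :: nat \<Rightarrow> real ^ 'n) (s :: nat \<Rightarrow> real \<Rightarrow> real ^ 'n).
        1 \<le> q \<and>
        \<gamma> 0 *\<^sub>R \<mu> 0 = v_init *\<^sub>R \<sigma>_init \<and>
        (\<sigma> 0, \<gamma> 0 *\<^sub>R \<mu> 0) \<in> fp_bundle F \<and>
        (\<forall>i\<in>{1..q}.
           \<gamma> i \<le> 1 \<and>
           \<mu> i = \<gamma> (i - 1) *\<^sub>R \<mu> (i - 1) + \<beta> i *\<^sub>R \<sigma> (i - 1) \<and>
           (\<forall>j. 0 < \<mu> i $ j) \<and>
           continuous_on {\<gamma> i..1} (s i) \<and>
           s i 1 = \<sigma> (i - 1) \<and> s i (\<gamma> i) = \<sigma> i \<and>
           (\<forall>g\<in>{\<gamma> i..1}. (s i g, g *\<^sub>R \<mu> i) \<in> fp_bundle F)) \<and>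
        \<gamma> q * (1 \<bullet> \<mu> q) = 0 \<and>
        \<sigma>_star = \<sigma> q \<and> VI_solution F \<sigma>_star \<and>
        \<Gamma> = (\<Union>i\<in>{1..q}. (\<lambda>g. (s i g, g *\<^sub>R \<mu> i)) ` {\<gamma> i..1}))"

definition softmax :: "real ^ 'n \<Rightarrow> real ^ 'n" where
  "softmax \<theta> = (\<chi> i. exp (\<theta> $ i) / (\<Sum>j\<in>UNIV. exp (\<theta> $ j)))"

definition ln_vec :: "real ^ 'n \<Rightarrow> real ^ 'n" where
  "ln_vec \<sigma> = (\<chi> i. ln (\<sigma> $ i))"

text \<open>For \<open>0 \<le> \<zeta>\<close> and a path \<open>\<Gamma>\<close>, the points \<open>(\<sigma>\<mu>, \<mu>)\<close> used below have \<open>\<mu> > 0\<close>, and being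
  in the bundle they have \<open>\<sigma>\<mu> > 0\<close>, so the totalised value \<open>ln 0 = 0\<close> never occurs.\<close>

definition path_neighborhood ::
  "((real ^ 'n) \<times> (real ^ 'n)) set \<Rightarrow> real \<Rightarrow> real \<Rightarrow> ((real ^ 'n) \<times> (real ^ 'n)) set" where
  "path_neighborhood \<Gamma> d \<zeta> =
     closure {(softmax \<theta>, \<mu>) |\<theta> \<mu>. \<exists>\<sigma>\<mu>. (\<sigma>\<mu>, \<mu>) \<in> \<Gamma> \<and> norm (\<theta> - ln_vec \<sigma>\<mu>) \<le> d \<and> \<zeta> < 1 \<bullet> \<mu>}"

end

theory Submission
  imports Defs
begin

text \<open>The singular manifold is compact: it is a continuous image of the compact set of pairs of a
  point of the simplex and a unit eigenvector, the eigenvalue being recovered as a Rayleigh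
  quotient. The part of the path with \<open>1 \<bullet> \<mu> \<ge> \<zeta>\<close> is compact as well, and it misses the
  singular manifold: since \<open>1 \<bullet> mu_tilde F \<sigma> = 0\<close>, the end point \<open>(\<sigma>_star, 0)\<close> could only be
  singular through the eigenvalue 0. So the two sets have positive distance. Moving
  \<open>ln \<sigma>\<close> by at most \<open>d\<close> moves \<open>\<sigma>\<close> by at most \<open>exp (2 * d) - 1\<close>, so a
  small \<open>d\<close> keeps the neighbourhood within that distance.\<close>

section \<open>Compactness of the simplex and continuity of matrix expressions\<close>

lemma inner_one_vec: "(1::real ^ 'n) \<bullet> x = (\<Sum>i\<in>UNIV. x $ i)"
  by (simp add: inner_vec_def)

lemma compact_simplex_set: "compact (simplex_set :: (real ^ 'n) set)"
proof -
  have "closed (simplex_set :: (real ^ 'n) set)"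
    unfolding simplex_set_def
    by (intro closed_Collect_conj closed_Collect_all closed_Collect_le closed_Collect_eq
        continuous_intros)
  moreover have "norm \<sigma> \<le> 1" if "\<sigma> \<in> simplex_set" for \<sigma> :: "real ^ 'n"
  proof -
    have "norm \<sigma> \<le> (\<Sum>i\<in>UNIV. \<bar>\<sigma> $ i\<bar>)"
      by (rule norm_le_l1_cart)
    then show ?thesis
      using that by (simp add: simplex_set_def inner_one_vec)
  qed
  ultimately show ?thesis
    by (auto simp: compact_eq_bounded_closed bounded_iff)
qed

lemma continuous_on_matrix_componentwise:
  fixes A :: "'a::topological_space \<Rightarrow> real ^ 'n ^ 'm"
  assumes "\<And>i j. continuous_on S (\<lambda>x. A x $ i $ j)"
  shows "continuous_on S A"
proof -
  have "continuous_on S (\<lambda>x. \<chi> i. \<chi> j. A x $ i $ j)"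
    by (intro continuous_on_vec_lambda assms)
  then show ?thesis
    by simp
qed

lemma continuous_on_matrix_mult:
  fixes A :: "'a::topological_space \<Rightarrow> real ^ 'n ^ 'm" and B :: "'a \<Rightarrow> real ^ 'p ^ 'n"
  assumes "continuous_on S A" "continuous_on S B"
  shows "continuous_on S (\<lambda>x. A x ** B x)"
  unfolding matrix_matrix_mult_def
  by (intro continuous_on_vec_lambda continuous_intros assms)

lemma continuous_on_matrix_vector_mult:
  fixes A :: "'a::topological_space \<Rightarrow> real ^ 'n ^ 'm" and v :: "'a \<Rightarrow> real ^ 'n"
  assumes "continuous_on S A" "continuous_on S v"
  shows "continuous_on S (\<lambda>x. A x *v v x)"
  unfolding matrix_vector_mult_def
  by (intro continuous_on_vec_lambda continuous_intros assms)

lemma continuous_on_vec_times: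
  fixes u v :: "'a::topological_space \<Rightarrow> real ^ 'n"
  assumes "continuous_on S u" "continuous_on S v"
  shows "continuous_on S (\<lambda>x. u x * v x)"
  unfolding times_vec_def
  by (intro continuous_on_vec_lambda continuous_intros assms)

lemma continuous_on_outer_product:
  fixes u v :: "'a::topological_space \<Rightarrow> real ^ 'n"
  assumes "continuous_on S u" "continuous_on S v"
  shows "continuous_on S (\<lambda>x. outer_product (u x) (v x))"
  unfolding outer_product_def
  by (intro continuous_on_vec_lambda continuous_intros assms)

lemma continuous_on_diag_matrix:
  fixes b :: "'a::topological_space \<Rightarrow> real ^ 'n"
  assumes "continuous_on S b"
  shows "continuous_on S (\<lambda>x. diag_matrix (b x))"
proof (rule continuous_on_matrix_componentwise)
  show "continuous_on S (\<lambda>x. diag_matrix (b x) $ i $ j)" for i j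
    \<comment> \<open>The conditional tests only the indices, so each fixed entry is either a
      component of \<open>b\<close> or constantly 0.\<close>
    by (cases "i = j") (auto simp: diag_matrix_def intro!: continuous_intros assms)
qed

section \<open>Continuity of the bundle data on the simplex\<close>

lemma continuous_on_smooth_simplex:
  assumes "smooth_on_simplex F"
  shows "continuous_on simplex_set F"
  using assms k_times_diff_on.simps(1)
  unfolding smooth_on_simplex_def by (metis continuous_on_subset)

text \<open>Column \<open>j\<close> of the Jacobian is the directional derivative along
  \<open>axis j 1\<close>, whose continuity is the order-one clause of smoothness.\<close>

lemma continuous_on_jacobian_simplex:
  fixes F :: "real ^ 'n \<Rightarrow> real ^ 'n"
  assumes "smooth_on_simplex F"
  shows "continuous_on simplex_set (\<lambda>\<sigma>. jacobian F (at \<sigma>))"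
proof (rule continuous_on_matrix_componentwise)
  fix i j
  obtain U where "simplex_set \<subseteq> U" "k_times_diff_on (Suc 0) F U"
    using assms unfolding smooth_on_simplex_def by blast
  then have "continuous_on simplex_set (\<lambda>\<sigma>. frechet_derivative F (at \<sigma>) (axis j 1))"
    by (auto intro: continuous_on_subset)
  then show "continuous_on simplex_set (\<lambda>\<sigma>. jacobian F (at \<sigma>) $ i $ j)"
    unfolding jacobian_def matrix_def by (simp add: continuous_on_component)
qed

lemma continuous_on_bundle_J:
  assumes "smooth_on_simplex F"
  shows "continuous_on simplex_set (bundle_J F k)"
  unfolding bundle_J_def
  by (intro continuous_on_add continuous_on_diff continuous_on_matrix_mult
      continuous_on_matrix_vector_mult continuous_on_outer_product continuous_on_diag_matrix
      continuous_on_scaleR continuous_on_const continuous_on_id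
      continuous_on_smooth_simplex continuous_on_jacobian_simplex assms)

lemma continuous_on_mu_tilde:
  assumes "smooth_on_simplex F"
  shows "continuous_on simplex_set (mu_tilde F)"
  unfolding mu_tilde_def
  by (intro continuous_on_diff continuous_on_vec_times continuous_on_matrix_vector_mult
      continuous_on_outer_product continuous_on_const continuous_on_id
      continuous_on_smooth_simplex[OF assms])

section \<open>Compactness of the singular manifold\<close>

lemma compact_singular_manifold:
  fixes F :: "real ^ 'n \<Rightarrow> real ^ 'n"
  assumes "smooth_on_simplex F"
  shows "compact (singular_manifold F k)"
proof -
  define C where "C = (simplex_set :: (real ^ 'n) set) \<times> sphere (0 :: real ^ 'n) 1"
  define R where "R p = snd p \<bullet> (bundle_J F k (fst p) *v snd p)" for p :: "(real ^ 'n) \<times> (real ^ 'n)"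
  \<comment> \<open>With \<open>R p\<close> in place of the eigenvalue, being an eigenvector is no
    longer an existential condition but an equation between continuous functions, so
    \<open>K\<close> is closed in \<open>C\<close>.\<close>
  define K where "K = {p \<in> C. fst p \<bullet> snd p = 0 \<and>
    bundle_J F k (fst p) *v snd p - R p *\<^sub>R snd p = 0}"
  define f where "f p = (fst p, mu_tilde F (fst p) - R p *\<^sub>R fst p)" for p
  have C: "compact C"
    unfolding C_def by (intro compact_Times compact_simplex_set compact_sphere)
  have J: "continuous_on C (\<lambda>p. bundle_J F k (fst p))"
    by (rule continuous_on_compose2[OF continuous_on_bundle_J[OF assms]])
      (auto simp: C_def intro!: continuous_intros)
  have mu: "continuous_on C (\<lambda>p. mu_tilde F (fst p))"
    by (rule continuous_on_compose2[OF continuous_on_mu_tilde[OF assms]])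
      (auto simp: C_def intro!: continuous_intros)
  have R: "continuous_on C R"
    unfolding R_def by (intro continuous_intros continuous_on_matrix_vector_mult J)
  have "K = {p \<in> C. fst p \<bullet> snd p = 0} \<inter>
      {p \<in> C. bundle_J F k (fst p) *v snd p - R p *\<^sub>R snd p = 0}"
    by (auto simp: K_def)
  moreover have "closed {p \<in> C. fst p \<bullet> snd p = 0}"
    by (intro continuous_closed_preimage_constant continuous_intros compact_imp_closed C)
  moreover have "closed {p \<in> C. bundle_J F k (fst p) *v snd p - R p *\<^sub>R snd p = 0}"
    by (intro continuous_closed_preimage_constant continuous_intros compact_imp_closed C
        continuous_on_matrix_vector_mult J R)
  ultimately have "closed K"
    by (simp add: closed_Int)
  moreover have "K = C \<inter> K"
    by (auto simp: K_def)
  ultimately have "compact K"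
    using C compact_Int_closed by metis
  moreover have "continuous_on K f"
    unfolding f_def by (rule continuous_on_subset[of C])
      (auto simp: K_def intro!: continuous_intros mu R)
  ultimately have "compact (f ` K)"
    by (rule compact_continuous_image[rotated])
  moreover have "singular_manifold F k = f ` K"
  proof (intro equalityI subsetI)
    fix p assume "p \<in> singular_manifold F k"
    then obtain \<sigma> ev w where p: "p = (\<sigma>, mu_tilde F \<sigma> - ev *\<^sub>R \<sigma>)" and \<sigma>: "\<sigma> \<in> simplex_set"
      and w: "w \<noteq> 0" "\<sigma> \<bullet> w = 0" "bundle_J F k \<sigma> *v w = ev *\<^sub>R w"
      by (auto simp: singular_manifold_def perp_eigenvalues_def)
    \<comment> \<open>Normalising keeps the eigenvalue, and for a unit vector the Rayleigh quotient
      is exactly \<open>ev\<close>.\<close>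
    define u where "u = w /\<^sub>R norm w"
    have u: "norm u = 1" "\<sigma> \<bullet> u = 0" "bundle_J F k \<sigma> *v u = ev *\<^sub>R u"
      using w by (simp_all add: u_def matrix_vector_mult_scaleR)
    then have "R (\<sigma>, u) = ev"
      by (simp add: R_def dot_square_norm)
    then have "(\<sigma>, u) \<in> K" "f (\<sigma>, u) = p"
      using u \<sigma> by (simp_all add: K_def C_def f_def p)
    then show "p \<in> f ` K"
      by force
  next
    fix p assume "p \<in> f ` K"
    then obtain \<sigma> u where p: "p = f (\<sigma>, u)" and "(\<sigma>, u) \<in> K"
      by auto
    then have "\<sigma> \<in> simplex_set" "u \<noteq> 0" "\<sigma> \<bullet> u = 0" "bundle_J F k \<sigma> *v u = R (\<sigma>, u) *\<^sub>R u"
      by (auto simp: K_def C_def)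
    then show "p \<in> singular_manifold F k"
      unfolding singular_manifold_def perp_eigenvalues_def p f_def by auto
  qed
  ultimately show ?thesis
    by simp
qed

section \<open>Singular points with vanishing second component\<close>

lemma outer_product_mult_vec: "outer_product u v *v x = (v \<bullet> x) *\<^sub>R u"
  by (simp add: outer_product_def matrix_vector_mult_def vec_eq_iff inner_vec_def
      sum_distrib_left ac_simps)

lemma projection_mult_vec: "(mat 1 - outer_product \<sigma> 1) *v x = x - (1 \<bullet> x) *\<^sub>R \<sigma>"
  by (simp add: matrix_vector_mult_diff_rdistrib outer_product_mult_vec)

text \<open>Here \<open>mu_tilde F \<sigma>\<close> has total mass 0 and \<open>\<sigma>\<close> has
  mass 1, so the second component has mass \<open>- ev\<close>. If that component is 0, then
  \<open>ev = 0\<close> and the eigenvector lies in the kernel.\<close>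

lemma zero_mem_singular_manifold_imp_not_invertible:
  assumes "(\<sigma>, 0) \<in> singular_manifold F k"
  shows "\<not> invertible (bundle_J F k \<sigma>)"
proof -
  obtain ev w where "\<sigma> \<in> simplex_set" and ev: "0 = mu_tilde F \<sigma> - ev *\<^sub>R \<sigma>"
    and w: "w \<noteq> 0" "bundle_J F k \<sigma> *v w = ev *\<^sub>R w"
    using assms by (auto simp: singular_manifold_def perp_eigenvalues_def)
  then have "1 \<bullet> \<sigma> = 1"
    by (simp add: simplex_set_def)
  then have "1 \<bullet> mu_tilde F \<sigma> = 0"
    by (simp add: mu_tilde_def projection_mult_vec inner_diff_right)
  then have "1 \<bullet> (mu_tilde F \<sigma> - ev *\<^sub>R \<sigma>) = - ev"
    using \<open>1 \<bullet> \<sigma> = 1\<close> by (simp add: inner_diff_right)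
  then have "ev = 0"
    using ev by (metis inner_zero_right neg_equal_0_iff_equal)
  then have "bundle_J F k \<sigma> *v w = 0"
    using w by simp
  with \<open>w \<noteq> 0\<close> show ?thesis
    by (metis invertible_def matrix_left_invertible_ker)
qed

section \<open>Positivity and compactness of the path\<close>

lemma fp_bundle_pos:
  assumes "(\<sigma>, \<mu>) \<in> fp_bundle F" "0 < \<mu> $ j"
  shows "0 < \<sigma> $ j"
proof -
  have \<sigma>: "0 \<le> \<sigma> $ j" and eq: "\<sigma> * F \<sigma> - \<mu> = (1 \<bullet> (\<sigma> * F \<sigma> - \<mu>)) *\<^sub>R \<sigma>"
    using assms by (auto simp: fp_bundle_def simplex_set_def bundle_map_def projection_mult_vec)
  \<comment> \<open>Bundle membership makes \<open>\<sigma> * F \<sigma> - \<mu>\<close> a multiple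
    of \<open>\<sigma>\<close>, so a zero of \<open>\<sigma>\<close> is also a zero of
    \<open>\<mu>\<close>.\<close>
  have "(\<sigma> * F \<sigma> - \<mu>) $ j = (1 \<bullet> (\<sigma> * F \<sigma> - \<mu>)) * \<sigma> $ j"
    by (subst eq) simp
  then have "\<mu> $ j = 0" if "\<sigma> $ j = 0"
    using that by simp
  then show ?thesis
    using \<sigma> assms(2) by force
qed

text \<open>Elimination rule exposing the path as finitely many graphs over compact intervals, for
  the compactness and positivity arguments.\<close>

lemma bundle_path_segments:
  assumes "bundle_path F \<sigma>_init v_init \<Gamma> \<sigma>_star"
  obtains q :: nat and \<gamma> m s
  where "\<Gamma> = (\<Union>i\<in>{1..q}. (\<lambda>g. (s i g, g *\<^sub>R m i)) ` {\<gamma> i..1})"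
    and "\<And>i j. i \<in> {1..q} \<Longrightarrow> 0 < m i $ j"
    and "\<And>i. i \<in> {1..q} \<Longrightarrow> continuous_on {\<gamma> i..1} (s i)"
    and "\<And>i g. i \<in> {1..q} \<Longrightarrow> g \<in> {\<gamma> i..1} \<Longrightarrow> (s i g, g *\<^sub>R m i) \<in> fp_bundle F"
  using assms unfolding bundle_path_def
  by - (elim conjE exE, rule that, assumption, blast+)

lemma compact_bundle_path:
  assumes "bundle_path F \<sigma>_init v_init \<Gamma> \<sigma>_star"
  shows "compact \<Gamma>"
  using assms
proof (rule bundle_path_segments)
  fix q :: nat and \<gamma> m s
  assume \<Gamma>: "\<Gamma> = (\<Union>i\<in>{1..q}. (\<lambda>g. (s i g, g *\<^sub>R m i)) ` {\<gamma> i..1})"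
    and s: "\<And>i. i \<in> {1..q} \<Longrightarrow> continuous_on {\<gamma> i..1} (s i)"
  show "compact \<Gamma>"
    unfolding \<Gamma>
    by (intro compact_UN compact_continuous_image continuous_on_Pair continuous_on_scaleR
        continuous_on_id continuous_on_const s) auto
qed

text \<open>On a segment \<open>\<mu>\<close> is a scalar multiple of a positive vector, so positive
  total mass forces a positive scalar and makes every entry of \<open>\<mu>\<close> positive. This
  guarantees that \<open>ln_vec\<close> takes genuine logarithms at the points generating the
  neighbourhood.\<close>

lemma bundle_path_pos:
  assumes "bundle_path F \<sigma>_init v_init \<Gamma> \<sigma>_star" "(\<sigma>, \<mu>) \<in> \<Gamma>" "0 < 1 \<bullet> \<mu>"
  shows "\<sigma> \<in> simplex_set \<and> (\<forall>j. 0 < \<sigma> $ j)"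
  using assms(1)
proof (rule bundle_path_segments)
  fix q :: nat and \<gamma> m s
  assume \<Gamma>: "\<Gamma> = (\<Union>i\<in>{1..q}. (\<lambda>g. (s i g, g *\<^sub>R m i)) ` {\<gamma> i..1})"
    and m: "\<And>i j. i \<in> {1..q} \<Longrightarrow> 0 < m i $ j"
    and E: "\<And>i g. i \<in> {1..q} \<Longrightarrow> g \<in> {\<gamma> i..1} \<Longrightarrow> (s i g, g *\<^sub>R m i) \<in> fp_bundle F"
  obtain i g where i: "i \<in> {1..q}" "g \<in> {\<gamma> i..1}" and p: "\<sigma> = s i g" "\<mu> = g *\<^sub>R m i"
    using assms(2) \<Gamma> by blast
  have "0 < 1 \<bullet> m i"
    unfolding inner_one_vec by (intro sum_pos m i(1)) auto
  then have "0 < g"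
    using assms(3) p by (simp add: zero_less_mult_iff)
  then have "0 < \<mu> $ j" for j
    using m i p by simp
  moreover have "(\<sigma>, \<mu>) \<in> fp_bundle F"
    using E i p by simp
  ultimately show ?thesis
    using fp_bundle_pos unfolding fp_bundle_def by blast
qed

section \<open>Perturbation of softmax in logarithmic coordinates\<close>

lemma norm_softmax_diff_le:
  fixes \<sigma> \<theta> :: "real ^ 'n"
  assumes "\<sigma> \<in> simplex_set" "\<And>j. 0 < \<sigma> $ j" "norm (\<theta> - ln_vec \<sigma>) \<le> d"
  shows "norm (softmax \<theta> - \<sigma>) \<le> exp (2 * d) - 1"
proof -
  define Z where "Z = (\<Sum>j\<in>UNIV. exp (\<theta> $ j))"
  have sum: "(\<Sum>j\<in>UNIV. \<sigma> $ j) = 1"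
    using assms(1) by (simp add: simplex_set_def inner_one_vec)
  have bounds: "\<sigma> $ j * exp (- d) \<le> exp (\<theta> $ j)" "exp (\<theta> $ j) \<le> \<sigma> $ j * exp d" for j
  proof -
    have "\<bar>(\<theta> - ln_vec \<sigma>) $ j\<bar> \<le> d"
      using component_le_norm_cart assms(3) by (rule order_trans)
    then have "ln (\<sigma> $ j) - d \<le> \<theta> $ j" "\<theta> $ j \<le> ln (\<sigma> $ j) + d"
      by (simp_all add: ln_vec_def abs_le_iff)
    then have "exp (ln (\<sigma> $ j) - d) \<le> exp (\<theta> $ j)" "exp (\<theta> $ j) \<le> exp (ln (\<sigma> $ j) + d)"
      by simp_all
    then show "\<sigma> $ j * exp (- d) \<le> exp (\<theta> $ j)" "exp (\<theta> $ j) \<le> \<sigma> $ j * exp d"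
      using assms(2)[of j] by (simp_all add: exp_add exp_diff exp_minus divide_inverse)
  qed
  \<comment> \<open>Since \<open>\<sigma>\<close> has mass 1, the normaliser \<open>Z\<close> obeys
    the same factors as the entries; numerator and denominator together cost the factor
    \<open>exp (2 * d)\<close>.\<close>
  have "(\<Sum>j\<in>UNIV. \<sigma> $ j * exp (- d)) \<le> Z" "Z \<le> (\<Sum>j\<in>UNIV. \<sigma> $ j * exp d)"
    unfolding Z_def by (intro sum_mono bounds)+
  then have Z: "exp (- d) \<le> Z" "Z \<le> exp d"
    by (simp_all add: sum flip: sum_distrib_right)
  have "0 < Z"
    using Z(1) exp_gt_zero by (rule less_le_trans[rotated])
  have "\<bar>(softmax \<theta> - \<sigma>) $ j\<bar> \<le> \<sigma> $ j * (exp (2 * d) - 1)" for j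
  proof -
    have "exp (\<theta> $ j) \<le> \<sigma> $ j * exp (2 * d) * exp (- d)"
      using bounds(2)[of j] by (simp add: mult.assoc flip: exp_add)
    also have "\<dots> \<le> \<sigma> $ j * exp (2 * d) * Z"
      using Z(1) assms(2)[of j] by simp
    finally have upper: "softmax \<theta> $ j \<le> \<sigma> $ j * exp (2 * d)"
      using \<open>0 < Z\<close> by (simp add: softmax_def pos_divide_le_eq flip: Z_def)
    have "\<sigma> $ j * exp (- (2 * d)) * Z \<le> \<sigma> $ j * exp (- (2 * d)) * exp d"
      using Z(2) assms(2)[of j] by simp
    also have "\<dots> \<le> exp (\<theta> $ j)"
      using bounds(1)[of j] by (simp add: mult.assoc flip: exp_add)
    finally have lower: "\<sigma> $ j * exp (- (2 * d)) \<le> softmax \<theta> $ j"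
      using \<open>0 < Z\<close> by (simp add: softmax_def pos_le_divide_eq flip: Z_def)
    \<comment> \<open>This gives \<open>1 - exp (- (2 * d)) \<le> exp (2 * d) - 1\<close>, so one
      bound covers deviations in both directions.\<close>
    have "2 \<le> exp (2 * d) + exp (- (2 * d))"
      using exp_ge_add_one_self[of "2 * d"] exp_ge_add_one_self[of "- (2 * d)"] by linarith
    then have "\<sigma> $ j * 2 \<le> \<sigma> $ j * (exp (2 * d) + exp (- (2 * d)))"
      using assms(2)[of j] by simp
    then show ?thesis
      using upper lower by (simp add: abs_le_iff algebra_simps)
  qed
  \<comment> \<open>The entrywise bounds carry the weights \<open>\<sigma> $ j\<close>, which sum to
    1, so no dimension factor appears.\<close>
  then have "(\<Sum>j\<in>UNIV. \<bar>(softmax \<theta> - \<sigma>) $ j\<bar>) \<le> (\<Sum>j\<in>UNIV. \<sigma> $ j * (exp (2 * d) - 1))"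
    by (rule sum_mono)
  also have "\<dots> = exp (2 * d) - 1"
    by (simp add: sum flip: sum_distrib_right)
  finally show ?thesis
    using norm_le_l1_cart order_trans by blast
qed

section \<open>Separation of the path neighbourhood from the singular manifold\<close>

theorem proposition10:
  fixes F :: "real ^ 'n \<Rightarrow> real ^ 'n"
    and k v_init \<zeta> :: real
    and \<sigma>_init \<sigma>_star :: "real ^ 'n"
    and \<Gamma> :: "((real ^ 'n) \<times> (real ^ 'n)) set"
  assumes "smooth_on_simplex F"
    and "k \<noteq> 0"
    and "bundle_path F \<sigma>_init v_init \<Gamma> \<sigma>_star"
    and "\<Gamma> \<inter> singular_manifold F k \<subseteq> {(\<sigma>_star, 0)}"
    and "0 \<le> \<zeta>"
    and "\<not> invertible (bundle_J F k \<sigma>_star) \<Longrightarrow> \<zeta> \<noteq> 0"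
  shows "\<exists>d>0. path_neighborhood \<Gamma> d \<zeta> \<inter> singular_manifold F k = {}"
proof -
  \<comment> \<open>The non-strict inequality keeps \<open>P\<close> closed. It can admit the end
    point only when \<open>\<zeta> = 0\<close>, the case where \<open>J\<close> is invertible at
    \<open>\<sigma>_star\<close>.\<close>
  define P where "P = \<Gamma> \<inter> {p. \<zeta> \<le> 1 \<bullet> snd p}"
  have "closed {p :: (real ^ 'n) \<times> (real ^ 'n). \<zeta> \<le> 1 \<bullet> snd p}"
    by (intro closed_Collect_le continuous_intros)
  then have "compact P"
    unfolding P_def using compact_bundle_path[OF assms(3)] by blast
  moreover have "closed (singular_manifold F k)"
    by (intro compact_imp_closed compact_singular_manifold assms)
  moreover have "P \<inter> singular_manifold F k = {}"
  proof (rule ccontr)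
    assume "P \<inter> singular_manifold F k \<noteq> {}"
    then obtain p where p: "p \<in> P" "p \<in> singular_manifold F k"
      by blast
    then have "p = (\<sigma>_star, 0)"
      using assms(4) by (auto simp: P_def)
    then have "\<zeta> = 0" "\<not> invertible (bundle_J F k \<sigma>_star)"
      using p assms(5) zero_mem_singular_manifold_imp_not_invertible by (auto simp: P_def)
    then show False
      using assms(6) by simp
  qed
  ultimately obtain e where e: "0 < e"
    "\<And>x y. x \<in> P \<Longrightarrow> y \<in> singular_manifold F k \<Longrightarrow> e \<le> dist x y"
    using separate_compact_closed by metis
  \<comment> \<open>Solves \<open>exp (2 * d) - 1 = e / 2\<close>: half of the separation
    \<open>e\<close> pays for the softmax perturbation, the other half for approximating a point of
    the closure.\<close>
  define d where "d = ln (1 + e / 2) / 2"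
  have "0 < d" and d: "exp (2 * d) - 1 = e / 2"
    using e(1) by (simp_all add: d_def)
  have "y \<notin> singular_manifold F k" if nbhd: "y \<in> path_neighborhood \<Gamma> d \<zeta>" for y
  proof
    assume y: "y \<in> singular_manifold F k"
    obtain \<theta> \<mu> \<sigma> where z: "dist (softmax \<theta>, \<mu>) y < e / 2"
      and \<Gamma>: "(\<sigma>, \<mu>) \<in> \<Gamma>" and \<theta>: "norm (\<theta> - ln_vec \<sigma>) \<le> d" and "\<zeta> < 1 \<bullet> \<mu>"
      using nbhd half_gt_zero[OF e(1)] unfolding path_neighborhood_def closure_approachable by blast
    then have "\<sigma> \<in> simplex_set" "\<And>j. 0 < \<sigma> $ j"
      using bundle_path_pos[OF assms(3) \<Gamma>] assms(5) by auto
    then have "norm (softmax \<theta> - \<sigma>) \<le> e / 2"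
      using norm_softmax_diff_le \<theta> d by metis
    then have "dist (\<sigma>, \<mu>) (softmax \<theta>, \<mu>) \<le> e / 2"
      by (simp add: dist_Pair_Pair dist_norm norm_minus_commute)
    \<comment> \<open>Strictness comes from the closure approximation, the softmax bound being
      non-strict.\<close>
    then have "dist (\<sigma>, \<mu>) y < e"
      using z dist_triangle[of "(\<sigma>, \<mu>)" y "(softmax \<theta>, \<mu>)"] by linarith
    moreover have "(\<sigma>, \<mu>) \<in> P"
      using \<Gamma> \<open>\<zeta> < 1 \<bullet> \<mu>\<close> by (simp add: P_def)
    ultimately show False
      using e(2) y by fastforce
  qed
  then show ?thesis
    using \<open>0 < d\<close> by blast
qed

end
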